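(* Let $(\Xi,\rho,\theta,\Sigma)$ be a continuous groupoid action and let $\Sigma_{\rm fix}\subset\Sigma$ be the set of its fixed points. The set $\Sigma_{\rm fix}$ is invariant. If $\Xi$ is open, $\Sigma_{\rm fix}$ is also closed.
   Context: All topological spaces are Hausdorff. A groupoid $\Xi$ is a small category in which all arrows are invertible; $X=\Xi^{(0)}$ is its unit space, $d,r:\Xi\to X$ are the source and range maps, and $\xi\eta$ is defined iff $d(\xi)=r(\eta)$. A topological groupoid is a groupoid with a (Hausdorff) topology making inversion and multiplication continuous (composable pairs carry the topology induced from $\Xi\times\Xi$); $X$ has the subspace topology. $\Xi$ is called open if $d:\Xi\to X$ is an open map. For $x\in X$, $\Xi_x=d^{-1}(\{x\})$. A continuous groupoid action $(\Xi,\rho,\theta,\Sigma)$ consists of a topological groupoid $\Xi$, a Hausdorff space $\Sigma$, a continuous surjection $\rho:\Sigma\to X$ (the anchor) and a continuous map $\theta:\{(\xi,\sigma)\in\Xi\times\Sigma: d(\xi)=\rho(\sigma)\}\to\Sigma$, $\theta_\xi(\sigma)=\xi\bullet\sigma$, with $\rho(\sigma)\bullet\sigma=\sigma$ and: if $d(\xi)=r(\eta)$ and $d(\eta)=\rho(\sigma)$ then $d(\xi)=\rho(\eta\bullet\sigma)$ and $(\xi\eta)\bullet\sigma=\xi\bullet(\eta\bullet\sigma)$. A subset $M\subset\Sigma$ is invariant if $\xi\bullet\sigma\in M$ whenever $\sigma\in M$ and $d(\xi)=\rho(\sigma)$. A point $\sigma$ is a fixed point if $\xi\bullet\sigma=\sigma$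 for every $\xi\in\Xi_{\rho(\sigma)}$. *)

theory Defs
  imports "HOL-Analysis.Abstract_Topological_Spaces"
begin

text \<open>A groupoid is given by its set \<open>G\<close> of arrows; objects are identified with their unit
  arrows, so the unit space \<open>X\<close> is a subset of \<open>G\<close>. The product \<open>mult \<xi> \<eta>\<close> is
  meaningful only when \<open>d \<xi> = r \<eta>\<close>; values of the operations outside the domains
  indicated in the axioms are unconstrained.\<close>

locale groupoid =
  fixes G :: "'g set" and X :: "'g set"
    and d :: "'g \<Rightarrow> 'g" and r :: "'g \<Rightarrow> 'g"
    and mult :: "'g \<Rightarrow> 'g \<Rightarrow> 'g" and inv :: "'g \<Rightarrow> 'g"
  assumes units_subset: "X \<subseteq> G"
    and source_in: "\<xi> \<in> G \<Longrightarrow> d \<xi> \<in> X"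
    and range_in: "\<xi> \<in> G \<Longrightarrow> r \<xi> \<in> X"
    and source_unit: "x \<in> X \<Longrightarrow> d x = x"
    and range_unit: "x \<in> X \<Longrightarrow> r x = x"
    and mult_in: "\<lbrakk>\<xi> \<in> G; \<eta> \<in> G; d \<xi> = r \<eta>\<rbrakk> \<Longrightarrow> mult \<xi> \<eta> \<in> G"
    and source_mult: "\<lbrakk>\<xi> \<in> G; \<eta> \<in> G; d \<xi> = r \<eta>\<rbrakk> \<Longrightarrow> d (mult \<xi> \<eta>) = d \<eta>"
    and range_mult: "\<lbrakk>\<xi> \<in> G; \<eta> \<in> G; d \<xi> = r \<eta>\<rbrakk> \<Longrightarrow> r (mult \<xi> \<eta>) = r \<xi>"
    and mult_assoc: "\<lbrakk>\<xi> \<in> G; \<eta> \<in> G; \<zeta> \<in> G; d \<xi> = r \<eta>; d \<eta> = r \<zeta>\<rbrakk>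
          \<Longrightarrow> mult (mult \<xi> \<eta>) \<zeta> = mult \<xi> (mult \<eta> \<zeta>)"
    and mult_source: "\<xi> \<in> G \<Longrightarrow> mult \<xi> (d \<xi>) = \<xi>"
    and range_mult_left: "\<xi> \<in> G \<Longrightarrow> mult (r \<xi>) \<xi> = \<xi>"
    and inv_in: "\<xi> \<in> G \<Longrightarrow> inv \<xi> \<in> G"
    and source_inv: "\<xi> \<in> G \<Longrightarrow> d (inv \<xi>) = r \<xi>"
    and range_inv: "\<xi> \<in> G \<Longrightarrow> r (inv \<xi>) = d \<xi>"
    and mult_inv_right: "\<xi> \<in> G \<Longrightarrow> mult \<xi> (inv \<xi>) = r \<xi>"
    and mult_inv_left: "\<xi> \<in> G \<Longrightarrow> mult (inv \<xi>) \<xi> = d \<xi>"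

locale topological_groupoid = groupoid "topspace \<Xi>" X d r mult inv
  for \<Xi> :: "'g topology" and X d r mult inv +
  assumes Hausdorff_groupoid: "Hausdorff_space \<Xi>"
    and continuous_inv: "continuous_map \<Xi> \<Xi> inv"
    and continuous_mult:
      "continuous_map (subtopology (prod_topology \<Xi> \<Xi>) {(\<xi>, \<eta>). d \<xi> = r \<eta>}) \<Xi>
         (\<lambda>(\<xi>, \<eta>). mult \<xi> \<eta>)"

definition open_groupoid :: "'g topology \<Rightarrow> 'g set \<Rightarrow> ('g \<Rightarrow> 'g) \<Rightarrow> bool" where
  "open_groupoid \<Xi> X d \<longleftrightarrow> open_map \<Xi> (subtopology \<Xi> X) d"

definition source_fiber :: "'g topology \<Rightarrow> ('g \<Rightarrow> 'g) \<Rightarrow> 'g \<Rightarrow> 'g set" where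
  "source_fiber \<Xi> d x = {\<xi> \<in> topspace \<Xi>. d \<xi> = x}"

locale continuous_groupoid_action = topological_groupoid \<Xi> X d r mult inv
  for \<Xi> :: "'g topology" and X d r mult inv +
  fixes \<rho> :: "'s \<Rightarrow> 'g" and \<theta> :: "'g \<Rightarrow> 's \<Rightarrow> 's" and \<Sigma> :: "'s topology"
  assumes Hausdorff_action_space: "Hausdorff_space \<Sigma>"
    and continuous_anchor: "continuous_map \<Sigma> (subtopology \<Xi> X) \<rho>"
    and anchor_surj: "\<rho> ` topspace \<Sigma> = X"
    and continuous_action:
      "continuous_map (subtopology (prod_topology \<Xi> \<Sigma>) {(\<xi>, \<sigma>). d \<xi> = \<rho> \<sigma>}) \<Sigma>
         (\<lambda>(\<xi>, \<sigma>). \<theta> \<xi> \<sigma>)"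
    and action_unit: "\<sigma> \<in> topspace \<Sigma> \<Longrightarrow> \<theta> (\<rho> \<sigma>) \<sigma> = \<sigma>"
    and anchor_action:
      "\<lbrakk>\<xi> \<in> topspace \<Xi>; \<eta> \<in> topspace \<Xi>; \<sigma> \<in> topspace \<Sigma>; d \<xi> = r \<eta>; d \<eta> = \<rho> \<sigma>\<rbrakk>
        \<Longrightarrow> d \<xi> = \<rho> (\<theta> \<eta> \<sigma>)"
    and action_mult:
      "\<lbrakk>\<xi> \<in> topspace \<Xi>; \<eta> \<in> topspace \<Xi>; \<sigma> \<in> topspace \<Sigma>; d \<xi> = r \<eta>; d \<eta> = \<rho> \<sigma>\<rbrakk>
        \<Longrightarrow> \<theta> (mult \<xi> \<eta>) \<sigma> = \<theta> \<xi> (\<theta> \<eta> \<sigma>)"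

definition invariant_subset ::
    "'g topology \<Rightarrow> ('g \<Rightarrow> 'g) \<Rightarrow> ('s \<Rightarrow> 'g) \<Rightarrow> ('g \<Rightarrow> 's \<Rightarrow> 's) \<Rightarrow> 's topology \<Rightarrow> 's set \<Rightarrow> bool" where
  "invariant_subset \<Xi> d \<rho> \<theta> \<Sigma> M \<longleftrightarrow>
     M \<subseteq> topspace \<Sigma> \<and> (\<forall>\<sigma>\<in>M. \<forall>\<xi>\<in>topspace \<Xi>. d \<xi> = \<rho> \<sigma> \<longrightarrow> \<theta> \<xi> \<sigma> \<in> M)"

definition fixed_points ::
    "'g topology \<Rightarrow> ('g \<Rightarrow> 'g) \<Rightarrow> ('s \<Rightarrow> 'g) \<Rightarrow> ('g \<Rightarrow> 's \<Rightarrow> 's) \<Rightarrow> 's topology \<Rightarrow> 's set" where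
  "fixed_points \<Xi> d \<rho> \<theta> \<Sigma> =
     {\<sigma> \<in> topspace \<Sigma>. \<forall>\<xi>\<in>source_fiber \<Xi> d (\<rho> \<sigma>). \<theta> \<xi> \<sigma> = \<sigma>}"

end

theory Submission
  imports Defs
begin

text \<open>A fixed point is moved by an arrow only to itself, so the set of fixed points is trivially
  invariant. For closedness, consider the pullback \<open>P = {(\<xi>, \<sigma>). d \<xi> = \<rho> \<sigma>}\<close> on which the
  action is defined. A point \<open>\<sigma>\<close> fails to be fixed exactly if it lies below some pair
  \<open>(\<xi>, \<sigma>) \<in> P\<close> with \<open>\<theta> \<xi> \<sigma> \<noteq> \<sigma>\<close>. These pairs form an open subset of \<open>P\<close>, because the action and
  the second projection are continuous maps into a Hausdorff space. The second projection
  \<open>P \<rightarrow> \<Sigma>\<close> is the base change of the source map \<open>d\<close> along the anchor \<open>\<rho>\<close>, and openness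
  survives base change (\<open>open_map_pullback_snd\<close>). So if \<open>d\<close> is open, the non-fixed points,
  being the image of an open set under this projection, form an open set.\<close>

text \<open>Inside a basic box \<open>U \<times> V\<close>, a point \<open>c \<in> V\<close> has a partner \<open>a \<in> U\<close> with \<open>f a = g c\<close>
  precisely if \<open>g c \<in> f ` U\<close>. Thus the pairs of the pullback in this box project onto the part of \<open>V\<close> over \<open>f ` U\<close>, which
  is open as soon as \<open>f\<close> is open and \<open>g\<close> continuous.\<close>

lemma open_map_pullback_snd:
  assumes f: "open_map A B f" and g: "continuous_map C B g"
  shows "open_map (subtopology (prod_topology A C) {(a, c). f a = g c}) C snd"
  unfolding open_map_def
proof (intro allI impI)
  fix W
  assume "openin (subtopology (prod_topology A C) {(a, c). f a = g c}) W"
  then obtain O' where O': "openin (prod_topology A C) O'"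
    and W: "W = O' \<inter> {(a, c). f a = g c}"
    by (auto simp: openin_subtopology)
  show "openin C (snd ` W)"
  proof (subst openin_subopen, intro ballI)
    fix c assume "c \<in> snd ` W"
    then obtain a where ac: "(a, c) \<in> O'" "f a = g c"
      unfolding W by fastforce
    then obtain U V where UV: "openin A U" "openin C V" "a \<in> U" "c \<in> V" "U \<times> V \<subseteq> O'"
      using O' unfolding openin_prod_topology_alt by meson
    define N where "N = {y \<in> topspace C. g y \<in> f ` U} \<inter> V"
    have "openin B (f ` U)"
      using f UV(1) by (simp add: open_map_def)
    then have "openin C N"
      unfolding N_def using openin_continuous_map_preimage[OF g] UV(2) by blast
    moreover have "c \<in> N"
      using ac(2) UV(3,4) openin_subset[OF UV(2)] unfolding N_def
      by (metis (mono_tags, lifting) IntI imageI mem_Collect_eq subsetD)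
    moreover have "N \<subseteq> snd ` W"
    proof
      fix y assume "y \<in> N"
      then obtain b where "b \<in> U" "y \<in> V" "f b = g y"
        unfolding N_def by fastforce
      then have "(b, y) \<in> W"
        using UV(5) W by blast
      then show "y \<in> snd ` W"
        by force
    qed
    ultimately show "\<exists>N. openin C N \<and> c \<in> N \<and> N \<subseteq> snd ` W"
      by blast
  qed
qed

lemma openin_continuous_maps_neq:
  assumes "Hausdorff_space Y" "continuous_map X Y f" "continuous_map X Y g"
  shows "openin X {x \<in> topspace X. f x \<noteq> g x}"
proof -
  have eq: "{x \<in> topspace X. f x \<noteq> g x} = topspace X - {x \<in> topspace X. f x = g x}"
    by auto
  show ?thesis
    unfolding eq using closedin_continuous_maps_eq[OF assms] by (rule openin_diff[OF openin_topspace])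
qed

context continuous_groupoid_action
begin

lemma invariant_fixed_points:
  "invariant_subset \<Xi> d \<rho> \<theta> \<Sigma> (fixed_points \<Xi> d \<rho> \<theta> \<Sigma>)"
  by (auto simp: invariant_subset_def fixed_points_def source_fiber_def)

lemma closedin_fixed_points:
  assumes "open_groupoid \<Xi> X d"
  shows "closedin \<Sigma> (fixed_points \<Xi> d \<rho> \<theta> \<Sigma>)"
proof -
  let ?P = "subtopology (prod_topology \<Xi> \<Sigma>) {(\<xi>, \<sigma>). d \<xi> = \<rho> \<sigma>}"
  let ?W = "{p \<in> topspace ?P. (\<lambda>(\<xi>, \<sigma>). \<theta> \<xi> \<sigma>) p \<noteq> snd p}"
  have "continuous_map ?P \<Sigma> snd"
    by (intro continuous_map_from_subtopology continuous_map_snd)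
  then have W: "openin ?P ?W"
    by (rule openin_continuous_maps_neq[OF Hausdorff_action_space continuous_action])
  have "open_map ?P \<Sigma> snd"
    using open_map_pullback_snd assms continuous_anchor unfolding open_groupoid_def by blast
  then have "openin \<Sigma> (snd ` ?W)"
    using W by (simp only: open_map_def)
  moreover have "snd ` ?W = topspace \<Sigma> - fixed_points \<Xi> d \<rho> \<theta> \<Sigma>"
    by (force simp: fixed_points_def source_fiber_def)
  moreover have "fixed_points \<Xi> d \<rho> \<theta> \<Sigma> \<subseteq> topspace \<Sigma>"
    by (auto simp: fixed_points_def)
  ultimately show ?thesis
    by (simp add: closedin_def)
qed

end

theorem proposition6p7:
  fixes \<Xi> :: "'g topology" and X :: "'g set"
    and d r :: "'g \<Rightarrow> 'g" and mult :: "'g \<Rightarrow> 'g \<Rightarrow> 'g" and inv :: "'g \<Rightarrow> 'g"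
    and \<rho> :: "'s \<Rightarrow> 'g" and \<theta> :: "'g \<Rightarrow> 's \<Rightarrow> 's" and \<Sigma> :: "'s topology"
  assumes "continuous_groupoid_action \<Xi> X d r mult inv \<rho> \<theta> \<Sigma>"
  shows "invariant_subset \<Xi> d \<rho> \<theta> \<Sigma> (fixed_points \<Xi> d \<rho> \<theta> \<Sigma>) \<and>
         (open_groupoid \<Xi> X d \<longrightarrow> closedin \<Sigma> (fixed_points \<Xi> d \<rho> \<theta> \<Sigma>))"
  using continuous_groupoid_action.invariant_fixed_points[OF assms]
    continuous_groupoid_action.closedin_fixed_points[OF assms] by blast

end
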